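(* Let $R\in(0,1)$ be the positive root of the equation $3x+2\log(1-x)=0$; numerically $R=0.5828\ldots$. Then for every $g(z)=\sum_{n=1}^{\infty}b_nz^n\in\mathcal{B}_0$ and every $r$ with $0\le r\le R$, $$\sum_{n=1}^{\infty}\frac{|b_n|}{n}\,r^n\le r .$$ Moreover, $R$ cannot be improved: there is no $R'\in(R,1)$ such that this inequality holds for all $g\in\mathcal{B}_0$ and all $0\le r\le R'$.
   Context: $\mathbb{D}=\{z\in\mathbb{C}:|z|<1\}$ is the open unit disk, $\mathcal{B}$ is the set of all analytic functions $f$ on $\mathbb{D}$ with $|f(z)|\le 1$ for all $z\in\mathbb{D}$, and $\mathcal{B}_0=\{f\in\mathcal{B}: f(0)=0\}$. $\log$ is the natural logarithm. The notation $R=0.5828\ldots$ means that the decimal expansion of $R$ begins with these digits. *)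

theory Defs
  imports "HOL-Analysis.Analysis"
begin

text \<open>
  Functions on the unit disk are total functions on the complex numbers of which only
  the values on \<open>ball 0 1\<close> matter.
\<close>

definition schur_class :: "(complex \<Rightarrow> complex) set" where
  "schur_class = {f. f holomorphic_on ball 0 1 \<and> (\<forall>z\<in>ball 0 1. norm (f z) \<le> 1)}"

definition schur_class0 :: "(complex \<Rightarrow> complex) set" where
  "schur_class0 = {f \<in> schur_class. f 0 = 0}"

text \<open>
  The series starts with the linear term, so the value \<open>b 0\<close> is never used.
\<close>

definition has_disk_expansion :: "(complex \<Rightarrow> complex) \<Rightarrow> (nat \<Rightarrow> complex) \<Rightarrow> bool" where
  "has_disk_expansion g b \<longleftrightarrow> (\<forall>z\<in>ball 0 1. (\<lambda>n. b (Suc n) * z ^ Suc n) sums g z)"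

end

theory Submission
  imports Defs "HOL-Complex_Analysis.Complex_Analysis"
begin

text \<open>
  Write \<open>g z = z * h z\<close> with \<open>h\<close> in the Schur class and put \<open>a = \<bar>b\<^sub>1\<bar>\<close>. All later coefficients satisfy
  \<open>\<bar>b\<^sub>n\<bar> \<le> 1 - a\<^sup>2\<close>, so the sum is at most \<open>a r + (1 - a\<^sup>2) (- ln (1 - r) - r)\<close>. If \<open>3 r + 2 ln (1 - r) \<ge> 0\<close>,
  this is at most \<open>r - (1 - a)\<^sup>2 r / 2\<close>. Conversely, for \<open>g z = z (z - a) / (1 - a z)\<close> the
  sum has a closed form, and letting \<open>a\<close> tend to \<open>1\<close> in the inequality, after division by
  \<open>1 - a\<close>, recovers the condition \<open>3 r + 2 ln (1 - r) \<ge> 0\<close>.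
\<close>

section \<open>Coefficient bounds in the Schur class\<close>

text \<open>Let \<open>t\<close> tend to 1 from below. This bridges \<open>Schwarz_Lemma\<close>,
  which asks for values of norm strictly below 1, and Schur functions, which may attain norm 1: the
  function is scaled by \<open>t\<close> first. A derivative then scales by \<open>t\<close> and a
  squared norm by \<open>t\<^sup>2\<close>.\<close>

lemma le_from_scaled_le:
  fixes a b c :: real
  assumes "\<And>t. 0 < t \<Longrightarrow> t < 1 \<Longrightarrow> t * a + t\<^sup>2 * b \<le> c"
  shows "a + b \<le> c"
proof -
  have "((\<lambda>t. t * a + t\<^sup>2 * b) \<longlongrightarrow> 1 * a + 1\<^sup>2 * b) (at_left 1)"
    by (intro tendsto_intros)
  moreover have "\<forall>\<^sub>F t in at_left 1. t * a + t\<^sup>2 * b \<le> c"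
    using eventually_at_left_real[OF zero_less_one] by eventually_elim (use assms in auto)
  ultimately show ?thesis
    using tendsto_upperbound by fastforce
qed

text \<open>Schwarz--Pick at the origin: a Moebius map sends the value at 0 to 0, and the Schwarz
  lemma bounds the derivative of the composition.\<close>

lemma schur_deriv_0_bound:
  assumes holf: "f holomorphic_on ball 0 1"
    and le1: "\<And>z. norm z < 1 \<Longrightarrow> norm (f z) \<le> 1"
  shows "norm (deriv f 0) + (norm (f 0))\<^sup>2 \<le> 1"
proof (rule le_from_scaled_le)
  fix t :: real assume t: "0 < t" "t < 1"
  define F where "F = (\<lambda>z. of_real t * f z)"
  define w where "w = F 0"
  have F_lt: "norm (F z) < 1" if "norm z < 1" for z
    using le1[OF that] t unfolding F_def norm_mult norm_of_real
    by (smt (verit, best) mult_left_le)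
  have w: "norm w < 1"
    unfolding w_def by (rule F_lt) simp
  have holF: "F holomorphic_on ball 0 1"
    unfolding F_def by (intro holomorphic_intros holf)
  define G where "G = Moebius_function 0 w \<circ> F"
  have "norm (deriv G 0) \<le> 1"
  proof (rule Schwarz_Lemma(2))
    show "G holomorphic_on ball 0 1"
      unfolding G_def
      by (rule holomorphic_on_compose_gen[OF holF Moebius_function_holomorphic[OF w]])
         (auto intro: F_lt)
    show "G 0 = 0"
      by (simp add: G_def w_def Moebius_function_eq_zero)
    show "norm (G z) < 1" if "norm z < 1" for z
      using Moebius_function_norm_lt_1[OF w F_lt[OF that]] by (simp add: G_def)
    show "norm (0 :: complex) < 1" by simp
  qed
  moreover have "deriv G 0 = of_real t * deriv f 0 / (1 - cnj w * w)"
  proof (rule DERIV_imp_deriv)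
    have f': "(f has_field_derivative deriv f 0) (at 0)"
      by (rule holomorphic_derivI[OF holf]) auto
    have F': "(F has_field_derivative of_real t * deriv f 0) (at 0)"
      unfolding F_def by (rule DERIV_cmult[OF f'])
    have nz: "1 - cnj w * w \<noteq> 0"
      using w by (metis complex_mod_cnj less_irrefl norm_mult_less norm_one mult_1 right_minus_eq)
    \<comment> \<open>The numerator vanishes at 0, so only one term of the quotient rule
      survives.\<close>
    have "((\<lambda>z. (F z - w) / (1 - cnj w * F z)) has_field_derivative
             of_real t * deriv f 0 / (1 - cnj w * w)) (at 0)"
      using nz by (auto intro!: derivative_eq_intros F' simp: w_def[symmetric])
    then show "(G has_field_derivative of_real t * deriv f 0 / (1 - cnj w * w)) (at 0)"
      by (simp add: G_def o_def Moebius_function_simple)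
  qed
  moreover have w2: "(norm w)\<^sup>2 < 1"
    using w by (simp add: abs_square_less_1)
  moreover have "1 - cnj w * w = of_real (1 - (norm w)\<^sup>2)"
    using complex_norm_square[of w] by (simp add: mult.commute)
  then have "norm (1 - cnj w * w) = \<bar>1 - (norm w)\<^sup>2\<bar>"
    by (simp only: norm_of_real)
  then have "norm (1 - cnj w * w) = 1 - (norm w)\<^sup>2"
    using w2 by simp
  ultimately have "t * norm (deriv f 0) \<le> 1 - (norm w)\<^sup>2"
    using t by (simp add: norm_divide norm_mult divide_le_eq)
  then show "t * norm (deriv f 0) + t\<^sup>2 * (norm (f 0))\<^sup>2 \<le> 1"
    using t by (simp add: w_def F_def norm_mult power_mult_distrib)
qed

text \<open>The sum is geometric with ratio \<open>q\<close>, an \<open>n\<close>-th root of unity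
  that equals 1 exactly when \<open>n\<close> divides \<open>m\<close>.\<close>

lemma sum_roots_of_unity_power:
  assumes "n > 0"
  shows "(\<Sum>j<n. (exp (2 * of_real pi * \<i> * of_nat j / of_nat n)) ^ m)
           = (if n dvd m then of_nat n else (0::complex))"
proof -
  define q :: complex where "q = exp (2 * of_real pi * \<i> * of_nat m / of_nat n)"
  have eq: "(exp (2 * of_real pi * \<i> * of_nat j / of_nat n)) ^ m = q ^ j" for j
    by (simp add: q_def mult_ac flip: exp_of_nat_mult)
  have "q ^ n = 1"
    unfolding q_def using assms by (intro complex_root_unity) auto
  moreover have "q = 1 \<longleftrightarrow> n dvd m"
    unfolding q_def using assms by (intro complex_root_unity_eq_1) auto
  ultimately show ?thesis
    unfolding eq by (cases "q = 1") (simp_all add: geometric_sum)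
qed

text \<open>
  Averaging over the \<open>n\<close>-th roots of unity keeps only the coefficients with index divisible
  by \<open>n\<close>; after the substitution \<open>w = z\<^sup>n\<close> the \<open>n\<close>-th coefficient becomes the first one, to which
  the Schwarz--Pick inequality at the origin applies.
\<close>

lemma schur_coeff_bound:
  fixes c :: "nat \<Rightarrow> complex"
  assumes sums: "\<And>z. norm z < 1 \<Longrightarrow> (\<lambda>k. c k * z ^ k) sums h z"
    and le1: "\<And>z. norm z < 1 \<Longrightarrow> norm (h z) \<le> 1"
    and n: "n > 0"
  shows "norm (c n) + (norm (c 0))\<^sup>2 \<le> 1"
proof -
  define H where "H = (\<lambda>w. \<Sum>k. c (n * k) * w ^ k)"
  have H: "(\<lambda>k. c (n * k) * w ^ k) sums H w \<and> norm (H w) \<le> 1" if w: "norm w < 1" for w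
  proof -
    obtain z where z: "z ^ n = w"
      using exists_complex_root[of n w] n by auto
    have z1: "norm z < 1"
    proof (rule ccontr)
      assume "\<not> norm z < 1"
      then have "1 \<le> norm z ^ n"
        by (intro one_le_power) simp
      then show False
        using w by (simp add: norm_power flip: z)
    qed
    define e where "e = (\<lambda>j::nat. exp (2 * of_real pi * \<i> * of_nat j / of_nat n) :: complex)"
    have ne: "norm (e j) = 1" for j
      by (simp add: e_def)
    have ez: "norm (e j * z) < 1" for j
      using z1 by (simp add: norm_mult ne)
    define S where "S = (\<Sum>j<n. h (e j * z))"
    have "(\<lambda>m. \<Sum>j<n. c m * (e j * z) ^ m) sums S"
      unfolding S_def by (intro sums_sum sums ez)
    moreover have "(\<Sum>j<n. c m * (e j * z) ^ m)
                     = (if n dvd m then of_nat n * (c m * z ^ m) else 0)" for m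
      using sum_roots_of_unity_power[OF n, of m]
      by (auto simp: e_def power_mult_distrib mult_ac simp flip: sum_distrib_left)
    ultimately have "(\<lambda>m. if n dvd m then of_nat n * (c m * z ^ m) else 0) sums S"
      by simp
    \<comment> \<open>All terms off the multiples of \<open>n\<close> vanish, so the series can be
      reindexed along them.\<close>
    then have "(\<lambda>k. of_nat n * (c (n * k) * z ^ (n * k))) sums S"
      using n by (subst (asm) sums_mono_reindex[of "\<lambda>k. n * k", symmetric])
                 (auto simp: strict_mono_def)
    then have "(\<lambda>k. of_nat n * (c (n * k) * w ^ k)) sums S"
      by (simp add: power_mult z)
    from sums_divide[OF this, of "of_nat n"]
    have S: "(\<lambda>k. c (n * k) * w ^ k) sums (S / of_nat n)"
      using n by simp
    moreover have "H w = S / of_nat n"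
      unfolding H_def using S by (rule sums_unique[symmetric])
    \<comment> \<open>\<open>S\<close> adds \<open>n\<close> values of \<open>h\<close>, each of
      norm at most 1, so the average \<open>H w\<close> inherits the bound.\<close>
    moreover have "norm S \<le> of_nat n"
      unfolding S_def using sum_norm_bound[of "{..<n}" "\<lambda>j. h (e j * z)" 1] le1[OF ez] by simp
    ultimately show ?thesis
      using n by (simp add: norm_divide)
  qed
  have "H holomorphic_on ball 0 1"
    by (rule power_series_holomorphic[where a = "\<lambda>k. c (n * k)"]) (use H in auto)
  then have "norm (deriv H 0) + (norm (H 0))\<^sup>2 \<le> 1"
    by (rule schur_deriv_0_bound) (use H in auto)
  moreover have "deriv H 0 = c n"
  proof -
    have "(H has_field_derivative (\<Sum>k. diffs (\<lambda>k. c (n * k)) k * 0 ^ k)) (at 0)"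
      unfolding H_def
      \<comment> \<open>Convergence at the point 1/2 of the disk suffices to differentiate termwise
        at 0.\<close>
      by (rule termdiffs_strong[where K = "1/2"]) (use H[of "1/2"] sums_summable in auto)
    then show ?thesis
      by (simp add: DERIV_imp_deriv diffs_def)
  qed
  moreover have "H 0 = c 0"
    by (simp add: H_def)
  ultimately show ?thesis by simp
qed

text \<open>The Schwarz lemma for \<open>t * g\<close>, followed by the limit in \<open>t\<close>;
  the summand 0 only fits the shape of \<open>le_from_scaled_le\<close>.\<close>

lemma schur_class0_norm_le:
  assumes "g \<in> schur_class0" "norm z < 1"
  shows "norm (g z) \<le> norm z"
proof -
  have "norm (g z) + 0 \<le> norm z"
  proof (rule le_from_scaled_le)
    fix t :: real assume t: "0 < t" "t < 1"
    have "norm (of_real t * g z) \<le> norm z"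
    proof (rule Schwarz_Lemma(1)[of "\<lambda>z. of_real t * g z"])
      show "(\<lambda>z. of_real t * g z) holomorphic_on ball 0 1"
        using assms by (intro holomorphic_intros) (auto simp: schur_class0_def schur_class_def)
      show "norm (of_real t * g x) < 1" if "norm x < 1" for x
      proof -
        have "norm (g x) \<le> 1"
          using assms that by (auto simp: schur_class0_def schur_class_def)
        then have "t * norm (g x) \<le> t"
          using t by (simp add: mult_left_le)
        then have "t * norm (g x) < 1"
          using t by linarith
        then show ?thesis
          using t by (simp add: norm_mult)
      qed
    qed (use assms in \<open>auto simp: schur_class0_def\<close>)
    then show "t * norm (g z) + t\<^sup>2 * 0 \<le> norm z"
      using t by (simp add: norm_mult)
  qed
  then show ?thesis by simp
qed

text \<open>The quotient \<open>g z / z\<close> is again bounded by 1, and dividing by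
  \<open>z\<close> shifts the coefficients by one, so \<open>schur_coeff_bound\<close> applies to
  it.\<close>

lemma schur_class0_coeff_bound:
  assumes g: "g \<in> schur_class0" and b: "has_disk_expansion g b" and n: "n > 0"
  shows "norm (b (Suc n)) + (norm (b 1))\<^sup>2 \<le> 1"
proof -
  define h where "h = (\<lambda>z. if z = 0 then b 1 else g z / z)"
  have sums: "(\<lambda>k. b (Suc k) * z ^ k) sums h z" if z: "norm z < 1" for z
  proof (cases "z = 0")
    case True
    then show ?thesis
      using powser_sums_zero[of "\<lambda>k. b (Suc k)"] by (simp add: h_def)
  next
    case False
    have "(\<lambda>n. b (Suc n) * z ^ Suc n / z) sums (g z / z)"
      using b z by (intro sums_divide) (simp add: has_disk_expansion_def)
    then show ?thesis
      using False by (simp add: h_def)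
  qed
  have le1: "norm (h z) \<le> 1" if z: "norm z < 1" "z \<noteq> 0" for z
    using schur_class0_norm_le[OF g z(1)] z(2) by (simp add: h_def norm_divide divide_le_eq)
  have "h holomorphic_on ball 0 1"
    by (rule power_series_holomorphic[where a = "\<lambda>k. b (Suc k)"]) (use sums in auto)
  \<comment> \<open>The Schwarz lemma bounds the quotient off 0 only; continuity carries the bound
    over to the removable singularity.\<close>
  then have "isCont h 0"
    by (metis at_within_open centre_in_ball continuous_on_eq_continuous_within
        holomorphic_on_imp_continuous_on open_ball zero_less_one)
  then have "((\<lambda>z. norm (h z)) \<longlongrightarrow> norm (h 0)) (at 0)"
    by (intro tendsto_norm) (simp add: isCont_def)
  moreover have "\<forall>\<^sub>F z in at 0. norm (h z) \<le> 1"
    using le1 by (auto simp: eventually_at intro!: exI[of _ 1])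
  ultimately have "norm (h 0) \<le> 1"
    using tendsto_upperbound by fastforce
  then have "norm (h z) \<le> 1" if "norm z < 1" for z
    using le1 that by (cases "z = 0") auto
  from schur_coeff_bound[OF sums this n] show ?thesis by simp
qed

section \<open>The logarithm series and the root of 3x + 2 log(1 - x)\<close>

lemma log_series_sums:
  fixes x :: real
  assumes "\<bar>x\<bar> < 1"
  shows "(\<lambda>n. x ^ Suc n / real (Suc n)) sums - ln (1 - x)"
proof -
  have "(\<lambda>n. - (x ^ n / real n)) sums ln (1 - x)"
    using ln_series'[of "-x"] assms by simp
  from sums_minus[OF this] have "(\<lambda>n. x ^ n / real n) sums - ln (1 - x)"
    by simp
  \<comment> \<open>Since \<open>x / 0 = 0\<close>, the term at index 0 is zero and the shift leaves
    the sum unchanged.\<close>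
  then show ?thesis
    by (subst sums_Suc_iff) simp
qed

text \<open>The derivative \<open>3 - 2 / (1 - x)\<close> changes sign at 1/3, the turning point
  used here and in the decreasing counterpart.\<close>

lemma three_x_plus_two_log_increasing:
  fixes x y :: real
  assumes "0 \<le> x" "x < y" "y \<le> 1/3"
  shows "3 * x + 2 * ln (1 - x) < 3 * y + 2 * ln (1 - y)"
proof (rule DERIV_pos_imp_increasing_open[OF assms(2)])
  show "\<exists>D. ((\<lambda>x. 3 * x + 2 * ln (1 - x)) has_real_derivative D) (at t) \<and> 0 < D"
    if "x < t" "t < y" for t
    using that assms
    by (intro exI[of _ "3 - 2 / (1 - t)"]) (auto intro!: derivative_eq_intros simp: field_simps)
  show "continuous_on {x..y} (\<lambda>x. 3 * x + 2 * ln (1 - x))"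
    using assms by (intro continuous_intros) auto
qed

lemma three_x_plus_two_log_decreasing:
  fixes x y :: real
  assumes "1/3 \<le> x" "x < y" "y < 1"
  shows "3 * y + 2 * ln (1 - y) < 3 * x + 2 * ln (1 - x)"
proof (rule DERIV_neg_imp_decreasing_open[OF assms(2)])
  show "\<exists>D. ((\<lambda>x. 3 * x + 2 * ln (1 - x)) has_real_derivative D) (at t) \<and> D < 0"
    if "x < t" "t < y" for t
    using that assms
    by (intro exI[of _ "3 - 2 / (1 - t)"]) (auto intro!: derivative_eq_intros simp: field_simps)
  show "continuous_on {x..y} (\<lambda>x. 3 * x + 2 * ln (1 - x))"
    using assms by (intro continuous_intros) auto
qed

lemma three_x_plus_two_log_at_05828: "3 * 0.5828 + 2 * ln (1 - 0.5828) > (0::real)"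
proof -
  \<comment> \<open>Here \<open>2500/1043 = 1 / (1 - 0.5828)\<close> and
    \<open>0.8742 = 3 * 0.5828 / 2\<close>.\<close>
  have "ln (2500/1043 :: real) < 0.8742"
    using ln_approx_bounds[of "2500/1043" 7] by (simp add: eval_nat_numeral)
  then show ?thesis
    using ln_inverse[of "2500/1043 :: real"] by simp
qed

lemma three_x_plus_two_log_at_05829: "3 * 0.5829 + 2 * ln (1 - 0.5829) < (0::real)"
proof -
  \<comment> \<open>Here \<open>10000/4171 = 1 / (1 - 0.5829)\<close> and
    \<open>0.87435 = 3 * 0.5829 / 2\<close>.\<close>
  have "ln (10000/4171 :: real) > 0.87435"
    using ln_approx_bounds[of "10000/4171" 5] by (simp add: eval_nat_numeral)
  then show ?thesis
    using ln_inverse[of "10000/4171 :: real"] by simp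
qed

text \<open>The function starts from 0 at 0, rises up to 1/3 and falls afterwards. Hence a positive
  root lies beyond 1/3, and the sign changes there once and for all.\<close>

lemma
  fixes R :: real
  assumes "0 < R" "R < 1" "3 * R + 2 * ln (1 - R) = 0"
  shows root_ge: "0.5828 \<le> R" and root_less: "R < 0.5829"
    and pos_upto_root: "\<And>r. 0 \<le> r \<Longrightarrow> r \<le> R \<Longrightarrow> 0 \<le> 3 * r + 2 * ln (1 - r)"
    and neg_beyond_root: "\<And>r. R < r \<Longrightarrow> r < 1 \<Longrightarrow> 3 * r + 2 * ln (1 - r) < 0"
proof -
  note inc = three_x_plus_two_log_increasing and dec = three_x_plus_two_log_decreasing
  have R3: "1/3 < R"
    using inc[of 0 R] assms by (cases "R \<le> 1/3") auto
  show "0.5828 \<le> R"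
    using dec[of R "0.5828"] R3 assms three_x_plus_two_log_at_05828 by (cases "R < 0.5828") auto
  show "R < 0.5829"
    using dec[of "0.5829" R] R3 assms three_x_plus_two_log_at_05829
    by (cases "R = 0.5829"; cases "R < 0.5829") auto
  show "0 \<le> 3 * r + 2 * ln (1 - r)" if "0 \<le> r" "r \<le> R" for r
    using inc[of 0 r] dec[of r R] that R3 assms
    by (cases "r = 0"; cases "r \<le> 1/3"; cases "r = R") auto
  show "3 * r + 2 * ln (1 - r) < 0" if "R < r" "r < 1" for r
    using dec[of R r] that R3 assms by simp
qed

text \<open>Existence is the intermediate value theorem between the two numerical values; of two
  roots, the larger would lie where the function is negative.\<close>

lemma ex1_root: "\<exists>!R::real. 0 < R \<and> R < 1 \<and> 3 * R + 2 * ln (1 - R) = 0"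
proof -
  have "\<exists>R::real. 0.5828 \<le> R \<and> R \<le> 0.5829 \<and> 3 * R + 2 * ln (1 - R) = 0"
    by (intro IVT2')
       (use three_x_plus_two_log_at_05828 three_x_plus_two_log_at_05829 in
         \<open>auto intro!: continuous_intros\<close>)
  then obtain R :: real where R_ge: "0.5828 \<le> R" and R_le: "R \<le> 0.5829"
    and root: "3 * R + 2 * ln (1 - R) = 0"
    by blast
  have R: "0 < R" "R < 1"
    using R_ge R_le by simp_all
  show ?thesis
  proof (rule ex1I[of _ R])
    fix R' :: real assume R': "0 < R' \<and> R' < 1 \<and> 3 * R' + 2 * ln (1 - R') = 0"
    show "R' = R"
    proof (rule ccontr)
      assume "R' \<noteq> R"
      then consider "R' < R" | "R < R'" by linarith
      then show False
        using neg_beyond_root[of R R'] neg_beyond_root[of R' R] R root R' by cases simp_all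
    qed
  qed (use R root in simp)
qed

section \<open>The inequality up to the root\<close>

lemma bohr_sum_bound:
  fixes r :: real
  assumes g: "g \<in> schur_class0" and b: "has_disk_expansion g b"
    and r: "0 \<le> r" "r < 1" and log: "0 \<le> 3 * r + 2 * ln (1 - r)"
  shows "summable (\<lambda>n. norm (b (Suc n)) / real (Suc n) * r ^ Suc n) \<and>
         (\<Sum>n. norm (b (Suc n)) / real (Suc n) * r ^ Suc n) \<le> r"
proof -
  define a where "a = norm (b 1)"
  \<comment> \<open>A termwise majorant: a multiple of the logarithm series, corrected at
    \<open>n = 0\<close> so that the linear term becomes \<open>a * r\<close>.\<close>
  define M where "M = (\<lambda>n. (1 - a\<^sup>2) * (r ^ Suc n / real (Suc n))
                          + (if n = 0 then (a - (1 - a\<^sup>2)) * r else 0))"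
  have M: "M sums ((1 - a\<^sup>2) * (- ln (1 - r)) + (a - (1 - a\<^sup>2)) * r)"
    unfolding M_def
    using r sums_single[of 0 "\<lambda>_. (a - (1 - a\<^sup>2)) * r"]
    by (intro sums_add sums_mult log_series_sums) simp_all
  have le_M: "norm (b (Suc n)) / real (Suc n) * r ^ Suc n \<le> M n" for n
  proof (cases "n = 0")
    case True
    then show ?thesis
      by (simp add: M_def a_def algebra_simps)
  next
    case False
    then have "norm (b (Suc n)) \<le> 1 - a\<^sup>2"
      using schur_class0_coeff_bound[OF g b, of n] by (simp add: a_def)
    then have "norm (b (Suc n)) * (r ^ Suc n / real (Suc n)) \<le> (1 - a\<^sup>2) * (r ^ Suc n / real (Suc n))"
      using r by (intro mult_right_mono) simp_all
    then show ?thesis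
      using False by (simp add: M_def)
  qed
  have nonneg: "0 \<le> norm (b (Suc n)) / real (Suc n) * r ^ Suc n" for n
    using r by simp
  have summable: "summable (\<lambda>n. norm (b (Suc n)) / real (Suc n) * r ^ Suc n)"
  proof (rule summable_comparison_test'[OF sums_summable[OF M]])
    show "norm (norm (b (Suc n)) / real (Suc n) * r ^ Suc n) \<le> M n" for n
      using le_M[of n] nonneg[of n] by (simp only: real_norm_def abs_of_nonneg)
  qed
  have le: "(\<Sum>n. norm (b (Suc n)) / real (Suc n) * r ^ Suc n)
              \<le> (1 - a\<^sup>2) * (- ln (1 - r)) + (a - (1 - a\<^sup>2)) * r"
    by (rule sums_le[OF le_M summable_sums[OF summable] M])
  \<comment> \<open>This makes the factor \<open>1 - a\<^sup>2\<close> nonnegative, so the logarithm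
    may be replaced by its bound \<open>3 / 2 * r\<close>.\<close>
  have "a\<^sup>2 \<le> 1"
    using schur_class0_coeff_bound[OF g b, of 1] norm_ge_zero[of "b (Suc 1)"]
    unfolding a_def by linarith
  then have "(1 - a\<^sup>2) * (- ln (1 - r)) \<le> (1 - a\<^sup>2) * (3 / 2 * r)"
    using log by (intro mult_left_mono) simp_all
  moreover have "(1 - a\<^sup>2) * (3 / 2 * r) + (a - (1 - a\<^sup>2)) * r = r - (1 - a)\<^sup>2 * r / 2"
    by (simp add: power2_eq_square field_simps)
  moreover have "0 \<le> (1 - a)\<^sup>2 * r / 2"
    using r by simp
  ultimately show ?thesis
    using summable le by linarith
qed

section \<open>Extremal functions and sharpness\<close>

text \<open>Taylor coefficients at 0 of \<open>z * (z - a) / (1 - a * z)\<close>.\<close>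

definition extremal_coeff :: "real \<Rightarrow> nat \<Rightarrow> complex" where
  "extremal_coeff a n =
     (if n = 1 then - of_real a else of_real (1 - a\<^sup>2) * of_real a ^ (n - 2))"

lemma extremal_in_schur_class0:
  fixes a :: real
  assumes "0 < a" "a < 1"
  shows "(\<lambda>z. z * Moebius_function 0 (of_real a) z) \<in> schur_class0"
proof -
  have a: "norm (of_real a :: complex) < 1"
    using assms by simp
  have "norm (z * Moebius_function 0 (of_real a) z) \<le> 1" if "norm z < 1" for z
    using that Moebius_function_norm_lt_1[OF a that, of 0]
    unfolding norm_mult by (intro mult_le_one) simp_all
  then show ?thesis
    unfolding schur_class0_def schur_class_def
    by (auto intro!: holomorphic_intros Moebius_function_holomorphic[OF a])
qed

text \<open>The function splits as
  \<open>- a * z + (1 - a\<^sup>2) * z\<^sup>2 / (1 - a * z)\<close>, and the last fraction is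
  expanded as a geometric series.\<close>

lemma extremal_has_disk_expansion:
  fixes a :: real
  assumes "0 < a" "a < 1"
  shows "has_disk_expansion (\<lambda>z. z * Moebius_function 0 (of_real a) z) (extremal_coeff a)"
  unfolding has_disk_expansion_def
proof
  fix z :: complex assume "z \<in> ball 0 1"
  then have "norm (of_real a * z) < 1"
    using assms mult_strict_mono'[of a 1 "norm z" 1] by (simp add: norm_mult)
  moreover from this have nz: "1 - of_real a * z \<noteq> 0"
    by auto
  ultimately have "(\<lambda>n. of_real (1 - a\<^sup>2) * z\<^sup>2 * (of_real a * z) ^ n)
                     sums (of_real (1 - a\<^sup>2) * z\<^sup>2 * (1 / (1 - of_real a * z)))"
    by (intro sums_mult geometric_sums)
  then have "(\<lambda>n. extremal_coeff a (Suc (Suc n)) * z ^ Suc (Suc n))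
               sums (of_real (1 - a\<^sup>2) * z\<^sup>2 / (1 - of_real a * z))"
    by (simp add: extremal_coeff_def power_mult_distrib power2_eq_square mult_ac)
  then have "(\<lambda>n. extremal_coeff a (Suc n) * z ^ Suc n)
               sums (of_real (1 - a\<^sup>2) * z\<^sup>2 / (1 - of_real a * z) + extremal_coeff a 1 * z)"
    by (subst (asm) sums_Suc_iff) simp
  moreover have "of_real (1 - a\<^sup>2) * z\<^sup>2 / (1 - of_real a * z) + extremal_coeff a 1 * z
                   = z * Moebius_function 0 (of_real a) z"
    using nz by (simp add: extremal_coeff_def Moebius_function_simple field_simps power2_eq_square)
  ultimately show "(\<lambda>n. extremal_coeff a (Suc n) * z ^ Suc n)
                     sums (z * Moebius_function 0 (of_real a) z)"
    by simp
qed

text \<open>From the second term on, this is a constant multiple of the logarithm series at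
  \<open>a * r\<close>. The series converges, so the infinite sum is a genuine value.\<close>

lemma extremal_bohr_sum:
  fixes a r :: real
  assumes a: "0 < a" "a < 1" and r: "0 \<le> r" "r < 1"
  shows "(\<Sum>n. norm (extremal_coeff a (Suc n)) / real (Suc n) * r ^ Suc n)
           = a * r + (1 - a\<^sup>2) / a\<^sup>2 * (- ln (1 - a * r) - a * r)"
proof -
  \<comment> \<open>Coefficient \<open>m + 2\<close> carries only \<open>a ^ m\<close>; dividing by
    \<open>a\<^sup>2\<close> makes up for the two missing powers.\<close>
  define k where "k = (1 - a\<^sup>2) / a\<^sup>2"
  have a2: "a\<^sup>2 < 1"
    using a by (simp add: abs_square_less_1)
  have "a * r < 1"
    using a r mult_strict_mono'[of a 1 r 1] by simp
  then have "(\<lambda>n. k * ((a * r) ^ Suc n / real (Suc n)) + (if n = 0 then a * r - k * (a * r) else 0))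
          sums (k * (- ln (1 - a * r)) + (a * r - k * (a * r)))"
    using a r sums_single[of 0 "\<lambda>_. a * r - k * (a * r)"]
    by (intro sums_add sums_mult log_series_sums) simp_all
  moreover have "norm (extremal_coeff a (Suc n)) / real (Suc n) * r ^ Suc n
      = k * ((a * r) ^ Suc n / real (Suc n)) + (if n = 0 then a * r - k * (a * r) else 0)" for n
  proof (cases n)
    case 0
    then show ?thesis
      using a by (simp add: extremal_coeff_def)
  next
    case (Suc m)
    have "norm (extremal_coeff a (Suc (Suc m))) = (1 - a\<^sup>2) * a ^ m"
      using a a2 by (simp add: extremal_coeff_def norm_mult norm_power del: of_real_diff)
    moreover have "(1 - a\<^sup>2) * a ^ m = k * a ^ Suc (Suc m)"
      using a by (simp add: k_def power2_eq_square)
    ultimately show ?thesis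
      using Suc by (simp add: power_mult_distrib)
  qed
  ultimately have "(\<lambda>n. norm (extremal_coeff a (Suc n)) / real (Suc n) * r ^ Suc n)
          sums (k * (- ln (1 - a * r)) + (a * r - k * (a * r)))"
    by (simp only:)
  from sums_unique[OF this] show ?thesis
    by (simp add: k_def right_diff_distrib)
qed

lemma bohr_radius_sharp:
  fixes r :: real
  assumes r: "0 \<le> r" "r < 1"
    and bound: "\<And>g b. g \<in> schur_class0 \<Longrightarrow> has_disk_expansion g b \<Longrightarrow>
                  (\<Sum>n. norm (b (Suc n)) / real (Suc n) * r ^ Suc n) \<le> r"
  shows "0 \<le> 3 * r + 2 * ln (1 - r)"
proof -
  \<comment> \<open>Both sides of the inequality for the extremal function contain the factor
    \<open>1 - a\<close>, which must be cancelled before the limit, where it would vanish.\<close>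
  have le: "(1 + a) * (- ln (1 - a * r) - a * r) \<le> a\<^sup>2 * r" if a: "0 < a" "a < 1" for a
  proof -
    have "a * r + (1 - a\<^sup>2) / a\<^sup>2 * (- ln (1 - a * r) - a * r) \<le> r"
      using bound[OF extremal_in_schur_class0[OF a] extremal_has_disk_expansion[OF a]]
      unfolding extremal_bohr_sum[OF a r] .
    then have "(1 - a\<^sup>2) / a\<^sup>2 * (- ln (1 - a * r) - a * r) \<le> (1 - a) * r"
      by (simp add: algebra_simps)
    then have "(1 - a\<^sup>2) * (- ln (1 - a * r) - a * r) \<le> (1 - a) * r * a\<^sup>2"
      using a by (simp add: pos_divide_le_eq)
    moreover have "1 - a\<^sup>2 = (1 - a) * (1 + a)"
      by (simp add: power2_eq_square algebra_simps)
    ultimately have "(1 - a) * ((1 + a) * (- ln (1 - a * r) - a * r)) \<le> (1 - a) * (a\<^sup>2 * r)"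
      by (simp only: mult_ac)
    then show ?thesis
      using a by (simp only: mult_le_cancel_left_pos diff_gt_0_iff_gt)
  qed
  \<comment> \<open>The limit is \<open>r - 2 * (- ln (1 - r) - r)\<close>, that is,
    \<open>3 * r + 2 * ln (1 - r)\<close>.\<close>
  have "((\<lambda>a. a\<^sup>2 * r - (1 + a) * (- ln (1 - a * r) - a * r))
           \<longlongrightarrow> 1\<^sup>2 * r - (1 + 1) * (- ln (1 - 1 * r) - 1 * r)) (at_left 1)"
    using r by (intro tendsto_intros) simp
  moreover have "\<forall>\<^sub>F a in at_left 1. 0 \<le> a\<^sup>2 * r - (1 + a) * (- ln (1 - a * r) - a * r)"
    using eventually_at_left_real[OF zero_less_one] by eventually_elim (use le in auto)
  ultimately have "0 \<le> 1\<^sup>2 * r - (1 + 1) * (- ln (1 - 1 * r) - 1 * r)"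
    by (rule tendsto_lowerbound) simp
  then show ?thesis by simp
qed

theorem corollary2p4:
  shows "(\<exists>!R::real. 0 < R \<and> R < 1 \<and> 3 * R + 2 * ln (1 - R) = 0) \<and>
    (\<forall>R::real. 0 < R \<and> R < 1 \<and> 3 * R + 2 * ln (1 - R) = 0 \<longrightarrow>
       0.5828 \<le> R \<and> R < 0.5829 \<and>
       (\<forall>g\<in>schur_class0. \<forall>b. has_disk_expansion g b \<longrightarrow>
          (\<forall>r. 0 \<le> r \<and> r \<le> R \<longrightarrow>
             summable (\<lambda>n. norm (b (Suc n)) / real (Suc n) * r ^ Suc n) \<and>
             (\<Sum>n. norm (b (Suc n)) / real (Suc n) * r ^ Suc n) \<le> r)) \<and>
       \<not> (\<exists>R'. R < R' \<and> R' < 1 \<and>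
          (\<forall>g\<in>schur_class0. \<forall>b. has_disk_expansion g b \<longrightarrow>
             (\<forall>r. 0 \<le> r \<and> r \<le> R' \<longrightarrow>
                (\<Sum>n. norm (b (Suc n)) / real (Suc n) * r ^ Suc n) \<le> r))))"
proof (intro conjI allI impI ballI ex1_root)
  fix R :: real
  assume "0 < R \<and> R < 1 \<and> 3 * R + 2 * ln (1 - R) = 0"
  then have R: "0 < R" "R < 1" "3 * R + 2 * ln (1 - R) = 0"
    by simp_all
  show "0.5828 \<le> R" "R < 0.5829"
    using root_ge[OF R] root_less[OF R] by simp_all
  fix g b and r :: real
  assume "g \<in> schur_class0" "has_disk_expansion g b" "0 \<le> r \<and> r \<le> R"
  then show "summable (\<lambda>n. norm (b (Suc n)) / real (Suc n) * r ^ Suc n)"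
    and "(\<Sum>n. norm (b (Suc n)) / real (Suc n) * r ^ Suc n) \<le> r"
    using bohr_sum_bound[of g b r] pos_upto_root[OF R, of r] R by auto
next
  fix R :: real
  assume "0 < R \<and> R < 1 \<and> 3 * R + 2 * ln (1 - R) = 0"
  then have R: "0 < R" "R < 1" "3 * R + 2 * ln (1 - R) = 0"
    by simp_all
  show "\<not> (\<exists>R'. R < R' \<and> R' < 1 \<and>
          (\<forall>g\<in>schur_class0. \<forall>b. has_disk_expansion g b \<longrightarrow>
             (\<forall>r. 0 \<le> r \<and> r \<le> R' \<longrightarrow>
                (\<Sum>n. norm (b (Suc n)) / real (Suc n) * r ^ Suc n) \<le> r)))"
  proof
    assume "\<exists>R'. R < R' \<and> R' < 1 \<and>
          (\<forall>g\<in>schur_class0. \<forall>b. has_disk_expansion g b \<longrightarrow>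
             (\<forall>r. 0 \<le> r \<and> r \<le> R' \<longrightarrow>
                (\<Sum>n. norm (b (Suc n)) / real (Suc n) * r ^ Suc n) \<le> r))"
    then obtain R' where R': "R < R'" "R' < 1"
      and bound: "\<forall>g\<in>schur_class0. \<forall>b. has_disk_expansion g b \<longrightarrow>
             (\<forall>r. 0 \<le> r \<and> r \<le> R' \<longrightarrow>
                (\<Sum>n. norm (b (Suc n)) / real (Suc n) * r ^ Suc n) \<le> r)"
      by blast
    have nonneg: "0 \<le> R'"
      using R R' by simp
    \<comment> \<open>The inequality at the single radius \<open>r = R'\<close> already contradicts
      the negative sign beyond the root.\<close>
    have "0 \<le> 3 * R' + 2 * ln (1 - R')"
      by (rule bohr_radius_sharp[OF nonneg R'(2)]) (use bound nonneg in blast)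
    then show False
      using neg_beyond_root[OF R R'] by simp
  qed
qed

end
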